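(* Let $\mathcal{Q}$ be a node query expressed by a key-invariant LocalSum GNN with continuous combination functions that never outputs a value in the open interval $(0,1)$ on keyed graphs. Then $\mathcal{Q}$ is expressed by a key-oblivious LocalSum GNN with continuous combination functions that uses the same combination functions.
   Context: Fix a finite set $\Pi=\{p_1,\dots,p_n\}$ of propositions. A graph is $G=(V,E,\mathrm{lab})$ with $V$ finite, $E\subseteq V\times V$ irreflexive and symmetric, $\mathrm{lab}:V\to\{0,1\}^n$; a pointed graph $G^u$ has distinguished node $u$; a node query is an isomorphism-closed class of pointed graphs. A keyed extension adds an injective $\mathrm{key}:V\to\mathbb{R}$. A GNN is a sequence of layers $(\mathrm{agg}_i,\mathrm{com}_i)_{i=1}^\ell$, $\mathrm{com}_i:\mathbb{R}^{2D_i}\to\mathbb{R}^{D_{i+1}}$, $D_{\ell+1}=1$; each layer computes $\mathrm{emb}'(u)=\mathrm{com}_i(\mathrm{emb}(u),\mathrm{agg}_i(\{\!\{\mathrm{emb}(v)\mid(u,v)\in E\}\!\}))$; output is the final value at the distinguished node. LocalSum: each $\mathrm{agg}_i$ is coordinate-wise sum. Key-invariant GNNs have $D_1=n+1$, initial embedding $\mathrm{lab}(v)\oplus(\mathrm{key}(v))$ on keyed graphs, accept iff output $>0$, are key-invariant if each pointed graph has all or none of its keyed extensions accepted, and then express the query of pointed graphs whose keyed extensions are accepted. Key-oblivious GNNs run on unkeyed graphs (in particular, one may feed a fixed constant in place of each key) and express the query of pointed graphs with output $>0$. *)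

theory Defs
  imports "HOL-Analysis.Analysis" "HOL-Analysis.Abstract_Euclidean_Space" "HOL-Library.Multiset"
begin

text \<open>
  Vectors of varying dimension are elements of the library space \<^const>\<open>Euclidean_space\<close>:
  sequences of reals whose entries at index \<open>d\<close> and beyond vanish.
\<close>

type_synonym rvec = "nat \<Rightarrow> real"

abbreviation Rn :: "nat \<Rightarrow> rvec set" where
  "Rn d \<equiv> topspace (Euclidean_space d)"

definition vconcat :: "nat \<Rightarrow> rvec \<Rightarrow> rvec \<Rightarrow> rvec" where
  "vconcat d x y = (\<lambda>i. if i < d then x i else y (i - d))"

definition vsingle :: "real \<Rightarrow> rvec" where
  "vsingle c = (\<lambda>i. if i = 0 then c else 0)"


record 'v graph =
  nodes :: "'v set"
  edges :: "('v \<times> 'v) set"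
  lab :: "'v \<Rightarrow> rvec"

definition is_graph :: "nat \<Rightarrow> 'v graph \<Rightarrow> bool" where
  "is_graph n G \<longleftrightarrow>
     finite (nodes G) \<and> edges G \<subseteq> nodes G \<times> nodes G \<and> irrefl (edges G) \<and> sym (edges G) \<and>
     (\<forall>v\<in>nodes G. lab G v \<in> Rn n \<and> (\<forall>i<n. lab G v i \<in> {0, 1}))"

type_synonym 'v pointed = "'v graph \<times> 'v"

definition pointed_graphs :: "nat \<Rightarrow> 'v pointed set" where
  "pointed_graphs n = {(G, u). is_graph n G \<and> u \<in> nodes G}"

definition pointed_iso :: "'v pointed \<Rightarrow> 'v pointed \<Rightarrow> bool" where
  "pointed_iso = (\<lambda>(G, u) (H, w).
     \<exists>f. bij_betw f (nodes G) (nodes H) \<and>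
         (\<forall>x\<in>nodes G. \<forall>y\<in>nodes G. (x, y) \<in> edges G \<longleftrightarrow> (f x, f y) \<in> edges H) \<and>
         (\<forall>x\<in>nodes G. lab H (f x) = lab G x) \<and> f u = w)"

definition node_query :: "nat \<Rightarrow> 'v pointed set \<Rightarrow> bool" where
  "node_query n Q \<longleftrightarrow> Q \<subseteq> pointed_graphs n \<and>
     (\<forall>P\<in>Q. \<forall>P'\<in>pointed_graphs n. pointed_iso P P' \<longrightarrow> P' \<in> Q)"

definition keyings :: "'v graph \<Rightarrow> ('v \<Rightarrow> real) set" where
  "keyings G = {key. inj_on key (nodes G)}"


record layer =
  dim_in :: nat
  dim_out :: nat
  agg :: "rvec multiset \<Rightarrow> rvec"
  com :: "rvec \<Rightarrow> rvec"

type_synonym gnn = "layer list"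

definition is_layer :: "layer \<Rightarrow> bool" where
  "is_layer L \<longleftrightarrow>
     (\<forall>M. set_mset M \<subseteq> Rn (dim_in L) \<longrightarrow> agg L M \<in> Rn (dim_in L)) \<and>
     com L \<in> Rn (2 * dim_in L) \<rightarrow> Rn (dim_out L)"

text \<open>The first argument is the input dimension; the output dimension is 1.\<close>

primrec is_gnn :: "nat \<Rightarrow> gnn \<Rightarrow> bool" where
  "is_gnn d [] \<longleftrightarrow> d = 1"
| "is_gnn d (L # Ls) \<longleftrightarrow> dim_in L = d \<and> is_layer L \<and> is_gnn (dim_out L) Ls"

definition local_sum :: "gnn \<Rightarrow> bool" where
  "local_sum N \<longleftrightarrow> (\<forall>L\<in>set N. \<forall>M. set_mset M \<subseteq> Rn (dim_in L) \<longrightarrow>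
     agg L M = (\<lambda>i. \<Sum>x\<in>#M. x i))"

definition continuous_coms :: "gnn \<Rightarrow> bool" where
  "continuous_coms N \<longleftrightarrow> (\<forall>L\<in>set N.
     continuous_map (Euclidean_space (2 * dim_in L)) (Euclidean_space (dim_out L)) (com L))"

definition same_coms :: "gnn \<Rightarrow> gnn \<Rightarrow> bool" where
  "same_coms N N' \<longleftrightarrow>
     list_all2 (\<lambda>L L'. dim_in L = dim_in L' \<and> dim_out L = dim_out L' \<and>
                       (\<forall>x\<in>Rn (2 * dim_in L). com L x = com L' x)) N N'"

definition layer_step :: "'v graph \<Rightarrow> layer \<Rightarrow> ('v \<Rightarrow> rvec) \<Rightarrow> 'v \<Rightarrow> rvec" where
  "layer_step G L emb u =
     com L (vconcat (dim_in L) (emb u)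
              (agg L (image_mset emb (mset_set {v. (u, v) \<in> edges G}))))"

primrec run :: "'v graph \<Rightarrow> gnn \<Rightarrow> ('v \<Rightarrow> rvec) \<Rightarrow> 'v \<Rightarrow> rvec" where
  "run G [] emb = emb"
| "run G (L # Ls) emb = run G Ls (layer_step G L emb)"


definition keyed_output :: "nat \<Rightarrow> gnn \<Rightarrow> 'v graph \<Rightarrow> ('v \<Rightarrow> real) \<Rightarrow> 'v \<Rightarrow> real" where
  "keyed_output n N G key u = run G N (\<lambda>v. vconcat n (lab G v) (vsingle (key v))) u 0"

definition key_invariant :: "'v itself \<Rightarrow> nat \<Rightarrow> gnn \<Rightarrow> bool" where
  "key_invariant _ n N \<longleftrightarrow> (\<forall>(G :: 'v graph, u) \<in> pointed_graphs n.
     (\<forall>key\<in>keyings G. keyed_output n N G key u > 0) \<or>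
     (\<forall>key\<in>keyings G. \<not> keyed_output n N G key u > 0))"

definition keyed_query :: "nat \<Rightarrow> gnn \<Rightarrow> 'v pointed set" where
  "keyed_query n N =
     {(G, u) \<in> pointed_graphs n. \<forall>key\<in>keyings G. keyed_output n N G key u > 0}"

text \<open>
  A key-oblivious network sees no keys: the coordinate holding the key is filled with one
  constant \<open>c\<close>, the same for all nodes of all graphs.
\<close>

definition oblivious_output :: "nat \<Rightarrow> real \<Rightarrow> gnn \<Rightarrow> 'v graph \<Rightarrow> 'v \<Rightarrow> real" where
  "oblivious_output n c N G u = run G N (\<lambda>v. vconcat n (lab G v) (vsingle c)) u 0"

definition oblivious_query :: "nat \<Rightarrow> real \<Rightarrow> gnn \<Rightarrow> 'v pointed set" where
  "oblivious_query n c N = {(G, u) \<in> pointed_graphs n. oblivious_output n c N G u > 0}"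

end

theory Submission imports Defs begin

text \<open>
  Feed the constant 0 in place of every key. The keyings \<open>f v / (k + 1)\<close>, for an injection \<open>f\<close> of
  the nodes into the reals, converge to the constant 0, so by continuity the keyed outputs converge
  to the key-oblivious output. Since the positive keyed outputs are at least 1, their limit is
  positive as well; since key invariance makes the sign independent of \<open>k\<close>, the limit is at most 0
  otherwise.
\<close>

text \<open>\<open>Euclidean_space d\<close> is a subspace of the product topology on all real
  sequences, where limits are coordinatewise. The assumption settles the requirement that the
  sequence eventually lie in the subspace.\<close>

lemma limitin_Euclidean_space:
  assumes "\<And>k. x k \<in> Rn d"
  shows "limitin (Euclidean_space d) x l sequentially \<longleftrightarrow>
           l \<in> Rn d \<and> (\<forall>i. (\<lambda>k. x k i) \<longlonglongrightarrow> l i)"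
  using assms
  by (auto simp: Euclidean_space_def limitin_subtopology limitin_componentwise)

lemma vconcat_in_Rn:
  assumes "x \<in> Rn d" "y \<in> Rn e"
  shows "vconcat d x y \<in> Rn (d + e)"
  using assms by (auto simp: topspace_Euclidean_space vconcat_def)

lemma vsingle_in_Rn: "vsingle c \<in> Rn 1"
  by (auto simp: topspace_Euclidean_space vsingle_def)

text \<open>Each neighbourhood is finite, so its sum converges coordinatewise, and
  \<open>com L\<close> is continuous. The two conclusions reproduce \<open>E\<close> and
  \<open>lim\<close> for the next layer.\<close>

lemma limitin_layer_step:
  fixes G :: "'v graph" and E :: "nat \<Rightarrow> 'v \<Rightarrow> rvec"
  assumes G: "is_graph n G" and L: "is_layer L"
    and sum: "\<And>M. set_mset M \<subseteq> Rn (dim_in L) \<Longrightarrow> agg L M = (\<lambda>i. \<Sum>x\<in>#M. x i)"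
    and cont: "continuous_map (Euclidean_space (2 * dim_in L)) (Euclidean_space (dim_out L)) (com L)"
    and E: "\<And>k v. v \<in> nodes G \<Longrightarrow> E k v \<in> Rn (dim_in L)"
    and lim: "\<And>v. v \<in> nodes G \<Longrightarrow>
                limitin (Euclidean_space (dim_in L)) (\<lambda>k. E k v) (e v) sequentially"
    and u: "u \<in> nodes G"
  shows "layer_step G L (E k) u \<in> Rn (dim_out L)"
    and "limitin (Euclidean_space (dim_out L))
           (\<lambda>k. layer_step G L (E k) u) (layer_step G L e u) sequentially"
proof -
  let ?A = "{v. (u, v) \<in> edges G}"
  define arg where
    "arg f = vconcat (dim_in L) (f u) (agg L (image_mset f (mset_set ?A)))" for f :: "'v \<Rightarrow> rvec"
  have A: "?A \<subseteq> nodes G" "finite ?A"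
    using G by (auto simp: is_graph_def intro: finite_subset[of ?A "nodes G"])
  have e: "e v \<in> Rn (dim_in L)" if "v \<in> nodes G" for v
    using lim[OF that] by (rule limitin_topspace)
  \<comment> \<open>Kept general in \<open>f\<close> to cover both the embeddings \<open>E k\<close>
    and their limit \<open>e\<close>. Membership in \<open>Rn\<close> matters because
    \<open>agg L\<close> is known to be the sum only there.\<close>
  have agg_eq: "agg L (image_mset f (mset_set ?A)) = (\<lambda>i. \<Sum>v\<in>?A. f v i)"
    and arg_in: "arg f \<in> Rn (2 * dim_in L)"
    if f: "\<And>v. v \<in> nodes G \<Longrightarrow> f v \<in> Rn (dim_in L)" for f
  proof -
    have sub: "set_mset (image_mset f (mset_set ?A)) \<subseteq> Rn (dim_in L)"
      using f A by auto
    show "agg L (image_mset f (mset_set ?A)) = (\<lambda>i. \<Sum>v\<in>?A. f v i)"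
      using sum[OF sub] by (simp add: sum_unfold_sum_mset image_mset.compositionality o_def)
    have "agg L (image_mset f (mset_set ?A)) \<in> Rn (dim_in L)"
      using L sub unfolding is_layer_def by blast
    then show "arg f \<in> Rn (2 * dim_in L)"
      using vconcat_in_Rn[OF f[OF u]] by (simp add: arg_def mult_2)
  qed
  have step: "layer_step G L f u = com L (arg f)" for f
    by (simp add: layer_step_def arg_def)
  show "layer_step G L (E k) u \<in> Rn (dim_out L)"
    using L arg_in[of "E k"] E by (auto simp: step is_layer_def)
  have comp: "(\<lambda>k. E k v i) \<longlonglongrightarrow> e v i" if "v \<in> nodes G" for v i
    using lim[OF that] limitin_Euclidean_space[of "\<lambda>k. E k v"] E[OF that] by blast
  have "(\<lambda>k. arg (E k) i) \<longlonglongrightarrow> arg e i" for i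
    using A u E e
    by (auto simp: arg_def vconcat_def agg_eq intro!: comp tendsto_sum)
  then have "limitin (Euclidean_space (2 * dim_in L)) (\<lambda>k. arg (E k)) (arg e) sequentially"
    using arg_in E e by (simp add: limitin_Euclidean_space)
  then show "limitin (Euclidean_space (dim_out L))
           (\<lambda>k. layer_step G L (E k) u) (layer_step G L e u) sequentially"
    using continuous_map_limit[OF cont] by (auto simp: step o_def)
qed

text \<open>Induction over the layers: each one turns a convergent sequence of embeddings into
  another, of a new dimension, so \<open>d\<close>, \<open>E\<close> and \<open>e\<close> must
  vary.\<close>

lemma tendsto_run:
  fixes G :: "'v graph" and E :: "nat \<Rightarrow> 'v \<Rightarrow> rvec"
  assumes "is_graph n G" "u \<in> nodes G"
    and "is_gnn d N" "local_sum N" "continuous_coms N"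
    and "\<And>k v. v \<in> nodes G \<Longrightarrow> E k v \<in> Rn d"
    and "\<And>v. v \<in> nodes G \<Longrightarrow> limitin (Euclidean_space d) (\<lambda>k. E k v) (e v) sequentially"
  shows "(\<lambda>k. run G N (E k) u i) \<longlonglongrightarrow> run G N e u i"
  using assms(3-)
proof (induction N arbitrary: d E e)
  case Nil
  then show ?case
    using limitin_Euclidean_space[of "\<lambda>k. E k u" d "e u"] \<open>u \<in> nodes G\<close> by simp
next
  case (Cons L N)
  have L: "dim_in L = d" "is_layer L" "is_gnn (dim_out L) N"
    using Cons.prems by auto
  have sum: "agg L M = (\<lambda>i. \<Sum>x\<in>#M. x i)" if "set_mset M \<subseteq> Rn (dim_in L)" for M
    using Cons.prems(2) that by (simp add: local_sum_def)
  have cont: "continuous_map (Euclidean_space (2 * dim_in L)) (Euclidean_space (dim_out L)) (com L)"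
    using Cons.prems(3) by (simp add: continuous_coms_def)
  have "(\<lambda>k. run G N (layer_step G L (E k)) u i) \<longlonglongrightarrow> run G N (layer_step G L e) u i"
  proof (rule Cons.IH[OF L(3)])
    show "local_sum N" "continuous_coms N"
      using Cons.prems by (auto simp: local_sum_def continuous_coms_def)
  \<comment> \<open>The remaining goals are the membership and convergence of the new
    embeddings.\<close>
  qed (use limitin_layer_step[OF \<open>is_graph n G\<close> L(2) sum cont, of E e] Cons.prems L(1) in auto)
  then show ?case by simp
qed

text \<open>The key is a single coordinate of the initial embedding, so the initial embeddings
  converge with the keys. The limit need not be an injective keying.\<close>

lemma keyed_output_tendsto_oblivious_output:
  assumes G: "is_graph n G" "u \<in> nodes G"
    and N: "is_gnn (n + 1) N" "local_sum N" "continuous_coms N"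
    and key: "\<And>v. v \<in> nodes G \<Longrightarrow> (\<lambda>k. key k v) \<longlonglongrightarrow> c"
  shows "(\<lambda>k. keyed_output n N G (key k) u) \<longlonglongrightarrow> oblivious_output n c N G u"
  unfolding keyed_output_def oblivious_output_def
proof (rule tendsto_run[OF G N])
  have lab: "lab G v \<in> Rn n" if "v \<in> nodes G" for v
    using G that by (simp add: is_graph_def)
  show emb: "vconcat n (lab G v) (vsingle (key k v)) \<in> Rn (n + 1)" if "v \<in> nodes G" for k v
    using vconcat_in_Rn[OF lab[OF that] vsingle_in_Rn] .
  show "limitin (Euclidean_space (n + 1)) (\<lambda>k. vconcat n (lab G v) (vsingle (key k v)))
          (vconcat n (lab G v) (vsingle c)) sequentially" if v: "v \<in> nodes G" for v
    unfolding limitin_Euclidean_space[OF emb[OF v]]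
    using vconcat_in_Rn[OF lab[OF v] vsingle_in_Rn] key[OF v]
    by (auto simp: vconcat_def vsingle_def)
qed

lemma keyings_tendsto_zero:
  assumes "finite (nodes G)"
  obtains key where "\<And>k. key k \<in> keyings G" "\<And>v. (\<lambda>k. key k v) \<longlonglongrightarrow> 0"
proof -
  obtain f :: "'a \<Rightarrow> nat" where f: "inj_on f (nodes G)"
    using finite_imp_inj_to_nat_seg[OF assms] by blast
  \<comment> \<open>The divisor is never 0, so every \<open>?key k\<close> inherits injectivity from
    \<open>f\<close>; division by 0 would collapse all keys to 0.\<close>
  let ?key = "\<lambda>k v. real (f v) / real (Suc k)"
  have "?key k \<in> keyings G" for k
    using f by (auto simp: keyings_def inj_on_def)
  moreover have "(\<lambda>k. ?key k v) \<longlonglongrightarrow> 0" for v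
    using LIMSEQ_Suc[OF lim_const_over_n[of "real (f v)"]] by simp
  ultimately show ?thesis using that[of ?key] by blast
qed

theorem theorem5p6:
  fixes n :: nat and Q :: "'v pointed set" and N :: gnn
  assumes "node_query n Q"
    and "is_gnn (n + 1) N"
    and "local_sum N"
    and "continuous_coms N"
    and "key_invariant TYPE('v) n N"
    and "Q = keyed_query n N"
    and "\<And>(G :: 'v graph) u key. (G, u) \<in> pointed_graphs n \<Longrightarrow> key \<in> keyings G \<Longrightarrow>
           keyed_output n N G key u \<notin> {0<..<1}"
  shows "\<exists>N' c. is_gnn (n + 1) N' \<and> local_sum N' \<and> continuous_coms N' \<and>
           same_coms N N' \<and> Q = oblivious_query n c N'"
proof -
  have iff: "(\<forall>key\<in>keyings G. keyed_output n N G key u > 0) \<longleftrightarrow> oblivious_output n 0 N G u > 0"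
    if Gu: "(G, u) \<in> pointed_graphs n" for G :: "'v graph" and u
  proof -
    have G: "is_graph n G" "u \<in> nodes G"
      using Gu by (auto simp: pointed_graphs_def)
    obtain key where key: "\<And>k. key k \<in> keyings G" "\<And>v. (\<lambda>k. key k v) \<longlonglongrightarrow> 0"
      using keyings_tendsto_zero[of G] G by (auto simp: is_graph_def)
    have lim: "(\<lambda>k. keyed_output n N G (key k) u) \<longlonglongrightarrow> oblivious_output n 0 N G u"
      using keyed_output_tendsto_oblivious_output[OF G assms(2-4)] key(2) by blast
    show ?thesis
    proof (cases "\<forall>key\<in>keyings G. keyed_output n N G key u > 0")
      case True
      \<comment> \<open>A strict bound could be lost in the limit; the gap (0,1) supplies a
        non-strict one.\<close>
      then have "keyed_output n N G (key k) u \<ge> 1" for k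
        using key(1)[of k] assms(7)[OF Gu key(1)[of k]] by fastforce
      then have "oblivious_output n 0 N G u \<ge> 1"
        by (intro LIMSEQ_le_const[OF lim]) blast
      then show ?thesis using True by simp
    next
      case False
      \<comment> \<open>The case gives just one rejecting keying; key invariance carries rejection
        over to every \<open>key k\<close>.\<close>
      then have "keyed_output n N G (key k) u \<le> 0" for k
        using key(1)[of k] assms(5) Gu unfolding key_invariant_def by fastforce
      then have "oblivious_output n 0 N G u \<le> 0"
        by (intro LIMSEQ_le_const2[OF lim]) blast
      then show ?thesis using False by simp
    qed
  qed
  \<comment> \<open>The witness is \<open>N\<close> itself, with constant 0.\<close>
  have "Q = oblivious_query n 0 N"
    unfolding assms(6) keyed_query_def oblivious_query_def using iff by auto
  moreover have "same_coms N N"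
    by (simp add: same_coms_def list.rel_refl)
  ultimately show ?thesis using assms(2-4) by blast
qed

end
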